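(* Let $f=h+\overline{g}:\mathbb{B}^n\to\mathbb{C}^n$ be a pluriharmonic mapping with $f(0)=0$, $|f_{\overline{z}}(0)|=0$ and $f_{z}(0)=I_{n}$ (the $n\times n$ identity matrix), where $h$ is a convex biholomorphic mapping and $g$ is a holomorphic mapping. Suppose that $|f_{\overline{z}}(z)|\leq |f_{z}(z)|$ for every $z\in\mathbb{B}^{n}$. Let $$\rho_{1}=\frac{1}{m_{2}+m_{3}},\qquad m_2=\min_{0<r<1}\frac{1+(1-r)^2}{r(1-r)^2}\approx 9.444,\qquad m_3=\min_{0<r<1}\frac{1}{r(1-r)^2}=6.75 .$$ Then $f$ is univalent in $\mathbb{B}^{n}(0,\rho_{1})$. Moreover, the range $f(\mathbb{B}^{n}(0,\rho_{1}))$ contains a univalent ball with center $0$ and radius at least $R_{1}=\frac{\rho_{1}}{2}$.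
   Context: $\mathbb{B}^n(a,r)=\{z\in\mathbb{C}^n:|z-a|<r\}$ and $\mathbb{B}^n=\mathbb{B}^n(0,1)$ (Euclidean norm). A mapping $f:\mathbb{B}^n\to\mathbb{C}^n$ is pluriharmonic if every component is pluriharmonic, equivalently $f=h+\overline g$ with $h,g:\mathbb{B}^n\to\mathbb{C}^n$ holomorphic. $f_z=(\partial f_i/\partial z_j)_{n\times n}$ and $f_{\overline z}=(\partial f_i/\partial\overline z_j)_{n\times n}$. For an $n\times n$ matrix $A$, $|A|=\max\{|A\theta|:\theta\in\partial\mathbb{B}^n\}$ is the operator norm. A holomorphic mapping $h:\mathbb{B}^n\to\mathbb{C}^n$ is convex if it is one-to-one and $h(\mathbb{B}^n)$ is a convex domain. Univalent means injective; a univalent ball contained in $f(U)$ is a ball $B$ for which there is a subregion of $U$ mapped by $f$ injectively onto $B$. *)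

theory Defs
  imports "HOL-Analysis.Analysis"
begin

text \<open>
  Complex differentiability is real (Frechet) differentiability with a complex linear
  derivative, i.e. one given by a complex matrix.
\<close>

definition holomorphic_map_on ::
  "(complex ^ 'n \<Rightarrow> complex ^ 'm) \<Rightarrow> (complex ^ 'n) set \<Rightarrow> bool" where
  "holomorphic_map_on f S \<longleftrightarrow>
     open S \<and> (\<forall>z\<in>S. \<exists>A :: complex ^ 'n ^ 'm. (f has_derivative (\<lambda>v. A *v v)) (at z))"

definition biholomorphic_map_on ::
  "(complex ^ 'n \<Rightarrow> complex ^ 'n) \<Rightarrow> (complex ^ 'n) set \<Rightarrow> bool" where
  "biholomorphic_map_on h S \<longleftrightarrow>
     holomorphic_map_on h S \<and>
     (\<exists>k. holomorphic_map_on k (h ` S) \<and> (\<forall>z\<in>S. k (h z) = z))"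

definition convex_map_on ::
  "(complex ^ 'n \<Rightarrow> complex ^ 'n) \<Rightarrow> (complex ^ 'n) set \<Rightarrow> bool" where
  "convex_map_on h S \<longleftrightarrow>
     holomorphic_map_on h S \<and> inj_on h S \<and> open (h ` S) \<and> convex (h ` S)"

definition cnj_vec :: "complex ^ 'n \<Rightarrow> complex ^ 'n" where
  "cnj_vec v = (\<chi> i. cnj (v $ i))"

text \<open>
  With \<open>z\<^sub>j = x\<^sub>j + \<i> y\<^sub>j\<close>, the real partial derivatives with respect to \<open>x\<^sub>j\<close> and \<open>y\<^sub>j\<close> are the
  values of the Frechet derivative at \<open>axis j 1\<close> and \<open>axis j \<i>\<close>, and
  \<open>\<partial>/\<partial>z\<^sub>j = (\<partial>/\<partial>x\<^sub>j - \<i> \<partial>/\<partial>y\<^sub>j) / 2\<close>, \<open>\<partial>/\<partial>\<bar>z\<^sub>j = (\<partial>/\<partial>x\<^sub>j + \<i> \<partial>/\<partial>y\<^sub>j) / 2\<close>.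
\<close>

definition jacobian_z ::
  "(complex ^ 'n \<Rightarrow> complex ^ 'm) \<Rightarrow> complex ^ 'n \<Rightarrow> complex ^ 'n ^ 'm" where
  "jacobian_z f z = (\<chi> i j.
     (frechet_derivative f (at z) (axis j 1) $ i
      - \<i> * frechet_derivative f (at z) (axis j \<i>) $ i) / 2)"

definition jacobian_zbar ::
  "(complex ^ 'n \<Rightarrow> complex ^ 'm) \<Rightarrow> complex ^ 'n \<Rightarrow> complex ^ 'n ^ 'm" where
  "jacobian_zbar f z = (\<chi> i j.
     (frechet_derivative f (at z) (axis j 1) $ i
      + \<i> * frechet_derivative f (at z) (axis j \<i>) $ i) / 2)"

definition matrix_norm :: "complex ^ 'n ^ 'm \<Rightarrow> real" where
  "matrix_norm A = onorm (\<lambda>v. A *v v)"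

definition univalent_ball_in ::
  "(complex ^ 'n \<Rightarrow> complex ^ 'n) \<Rightarrow> (complex ^ 'n) set \<Rightarrow> complex ^ 'n \<Rightarrow> real \<Rightarrow> bool" where
  "univalent_ball_in f U a R \<longleftrightarrow>
     (\<exists>V. V \<subseteq> U \<and> open V \<and> connected V \<and> bij_betw f V (ball a R))"

text \<open>
  The infima below are minima, see \<open>m2_attained\<close> and \<open>m3_attained\<close>.
\<close>

definition m2 :: real where
  "m2 = (INF r\<in>{0<..<1}. (1 + (1 - r)\<^sup>2) / (r * (1 - r)\<^sup>2))"

definition m3 :: real where
  "m3 = (INF r\<in>{0<..<1}. 1 / (r * (1 - r)\<^sup>2))"

definition rho1 :: real where
  "rho1 = 1 / (m2 + m3)"

definition R1 :: real where
  "R1 = rho1 / 2"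

lemma Inf_eq_minimum:
  fixes F :: "real \<Rightarrow> real"
  assumes "r \<in> S" and "\<And>x. x \<in> S \<Longrightarrow> F r \<le> F x"
  shows "(INF x\<in>S. F x) = F r"
  using assms by (intro cInf_eq_minimum) auto

lemma m3_minimum:
  fixes r :: real
  assumes "0 < r" "r < 1"
  shows "27 / 4 \<le> 1 / (r * (1 - r)\<^sup>2)"
proof -
  have "0 \<le> (r - 1/3)\<^sup>2 * (4/3 - r)" using assms by simp
  also have "\<dots> = 4/27 - r * (1 - r)\<^sup>2" by (simp add: power2_eq_square field_simps)
  finally have "r * (1 - r)\<^sup>2 \<le> 4/27" by simp
  moreover have "0 < r * (1 - r)\<^sup>2" using assms by simp
  ultimately show ?thesis by (simp add: le_divide_eq)
qed

lemma m3_eq: "m3 = 27 / 4"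
proof -
  have "m3 = 1 / (1/3 * (1 - 1/3)\<^sup>2)"
    unfolding m3_def
  proof (rule Inf_eq_minimum)
    fix x :: real
    assume "x \<in> {0<..<1}"
    then show "1 / (1/3 * (1 - 1/3)\<^sup>2) \<le> 1 / (x * (1 - x)\<^sup>2)"
      using m3_minimum[of x] by (simp add: power2_eq_square)
  qed auto
  then show ?thesis by (simp add: power2_eq_square)
qed

lemma m3_attained: "\<exists>r\<in>{0<..<1}. m3 = 1 / (r * (1 - r)\<^sup>2)"
  by (rule bexI[of _ "1/3"]) (auto simp: m3_eq power2_eq_square)

lemma m2_attained: "\<exists>r\<in>{0<..<1}. m2 = (1 + (1 - r)\<^sup>2) / (r * (1 - r)\<^sup>2)"
proof -
  define F where "F = (\<lambda>r::real. (1 + (1 - r)\<^sup>2) / (r * (1 - r)\<^sup>2))"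
  have "continuous_on {1/10..9/10} F"
    unfolding F_def by (intro continuous_intros) auto
  then obtain r where r: "r \<in> {1/10..9/10}" "\<And>x. x \<in> {1/10..9/10} \<Longrightarrow> F r \<le> F x"
    using continuous_attains_inf[of "{1/10..9/10::real}" F] by auto
  have "F r \<le> F (2/5)" using r(2)[of "2/5"] by simp
  also have "\<dots> \<le> 10" by (simp add: F_def power2_eq_square)
  finally have le10: "F r \<le> 10" .
  have "F r \<le> F x" if x: "x \<in> {0<..<1}" for x
  proof (cases "x \<in> {1/10..9/10}")
    case False
    have split: "F x = 1 / (x * (1 - x)\<^sup>2) + 1 / x"
      using x by (simp add: F_def field_simps)
    have pos: "0 < x * (1 - x)\<^sup>2" using x by simp
    have "10 \<le> F x"
    proof (cases "x < 1/10")
      case True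
      then have "10 \<le> 1 / x" using x by (simp add: le_divide_eq)
      then show ?thesis using pos split by (simp add: order_trans)
    next
      case c: False
      then have "(1 - x)\<^sup>2 \<le> (1/10)\<^sup>2" using x False by (intro power_mono) auto
      then have "x * (1 - x)\<^sup>2 \<le> 1 * (1/10)\<^sup>2" using x by (intro mult_mono) auto
      then have "10 \<le> 1 / (x * (1 - x)\<^sup>2)"
        using pos by (simp add: le_divide_eq power2_eq_square)
      then show ?thesis using x split by (simp add: add_increasing2)
    qed
    with le10 show ?thesis by simp
  qed (use r in auto)
  moreover have r01: "r \<in> {0<..<1}" using r by auto
  ultimately have "m2 = F r"
    unfolding m2_def F_def by (intro Inf_eq_minimum) auto
  with r01 show ?thesis by (auto simp: F_def)
qed

lemma m2_approx: "9.4435 < m2 \<and> m2 < 9.4445"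
proof -
  have "m2 \<le> (1 + (1 - 81/200)\<^sup>2) / (81/200 * (1 - 81/200)\<^sup>2)"
    unfolding m2_def by (rule cINF_lower) (auto intro!: bdd_belowI[of _ 0])
  also have "\<dots> < 9.4445" by (simp add: power2_eq_square)
  finally have upper: "m2 < 9.4445" .
  obtain r where r: "0 < r" "r < 1" and m2: "m2 = (1 + (1 - r)\<^sup>2) / (r * (1 - r)\<^sup>2)"
    using m2_attained by auto
  define s where "s = 1 - r"
  define a b :: real where "a = 9.4435" and "b = 8.4435"
  have s: "0 < s" "s < 1" using r by (auto simp: s_def)
  have "a * s^3 - b * s^2 + 1
      = (s - 2 * b / (3 * a))\<^sup>2 * (a * s + b / 3) + (1 - 4 * b^3 / (27 * a^2))"
    by (simp add: a_def power2_eq_square power3_eq_cube field_simps)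
  moreover have "0 \<le> (s - 2 * b / (3 * a))\<^sup>2 * (a * s + b / 3)"
    using s by (simp add: a_def b_def)
  moreover have "0 < 1 - 4 * b^3 / (27 * a^2)"
    by (simp add: a_def b_def power2_eq_square power3_eq_cube)
  ultimately have "0 < a * s^3 - b * s^2 + 1" by linarith
  also have "\<dots> = 1 + s^2 - a * ((1 - s) * s^2)"
    by (simp add: a_def b_def power2_eq_square power3_eq_cube field_simps)
  finally have "a * (r * (1 - r)\<^sup>2) < 1 + (1 - r)\<^sup>2" by (simp add: s_def)
  then have "a < m2" using r by (simp add: m2 less_divide_eq)
  with upper show ?thesis by (simp add: a_def)
qed

end

theory Submission
  imports Defs "HOL-Complex_Analysis.Riemann_Mapping"
begin

text \<open>
  Write \<open>f z = z + e z\<close>. The constant term of \<open>h + cnj g\<close> vanishes because \<open>f 0 = 0\<close>, so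
  \<open>e = H + cnj (g - g 0)\<close> with \<open>H z = h z - h 0 - z\<close>, and the normalization says that the holomorphic
  mappings \<open>H\<close> and \<open>g\<close> both have derivative \<open>0\<close> at the origin. The theorem follows from

  \<open>|e z - e w| \<le> K max(|z|, |w|) |z - w|\<close> with \<open>K = m2 + m3\<close> on the closed ball of radius \<open>1 / K\<close>

  by a general fact about perturbations of the identity (\<open>perturbed_identity_univalent\<close>): \<open>e\<close>
  contracts distances in the open ball, which gives injectivity, and \<open>|e z| \<le> K |z|\<^sup>2 / 2\<close>, which by
  Brouwer's fixed point theorem gives a univalent ball of radius \<open>1 / (2 K)\<close>.

  The bound on \<open>e\<close> has three ingredients.

  First, convexity of \<open>h\<close> bounds its Taylor coefficients along complex lines through the origin by \<open>1\<close>
  (\<open>convex_map_coeff_bound\<close>): averages over roots of unity stay in the convex image, and can be pulled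
  back by the inverse of \<open>h\<close> to curves in the ball, where the Schwarz lemma applies. Summation gives
  \<open>|h z - h 0| \<le> |z| / (1 - |z|)\<close> and \<open>|H z| \<le> |z|\<^sup>2 / (1 - |z|)\<close> (\<open>convex_map_growth\<close>).

  Second, a Schwarz--Pick estimate on the discs in which complex lines meet a ball turns these bounds
  on the ball of radius \<open>1/2\<close> into bounds \<open>25/8\<close> and \<open>25/16\<close> for the derivatives of \<open>h\<close> and \<open>H\<close>
  on the ball of radius \<open>3/10\<close> (\<open>derivative_bound_ball\<close>). The domination hypothesis transfers the
  first of these bounds to \<open>g\<close>: the matrix \<open>jacobian_zbar f z\<close> is the complex conjugate of the Jacobian
  of \<open>g\<close>, so both have the same operator norm.

  Third, a Schwarz lemma of order two applied to \<open>t \<mapsto> G (t z) - G (t w)\<close> improves a Lipschitz bound \<open>L\<close>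
  on the ball of radius \<open>r\<close> to \<open>(L / r) max(|z|, |w|) |z - w|\<close> if \<open>G\<close> has derivative \<open>0\<close> at the
  origin (\<open>difference_bound_of_critical_point\<close>). For \<open>G = g\<close> and \<open>G = H\<close> with \<open>r = 3/10\<close> the
  constants add up to \<open>125/12 + 125/24 = 125/8 = 15.625\<close>, and \<open>m2 + m3 \<approx> 16.194\<close>.
\<close>

section \<open>The Hermitian product on complex vectors\<close>

definition hermitian :: "complex ^ 'n \<Rightarrow> complex ^ 'n \<Rightarrow> complex" where
  "hermitian x a = (\<Sum>i\<in>UNIV. x $ i * cnj (a $ i))"

lemma norm_vector_scaleC: "norm (c *s x) = norm c * norm (x :: complex ^ 'n)"
  by (simp add: norm_vec_def norm_mult L2_set_right_distrib)

lemma hermitian_Cauchy_Schwarz: "norm (hermitian x a) \<le> norm x * norm a"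
proof -
  have "norm (hermitian x a) \<le> (\<Sum>i\<in>UNIV. \<bar>norm (x $ i)\<bar> * \<bar>norm (a $ i)\<bar>)"
    unfolding hermitian_def by (rule order_trans[OF norm_sum]) (simp add: norm_mult)
  also have "\<dots> \<le> norm x * norm a"
    unfolding norm_vec_def by (rule L2_set_mult_ineq)
  finally show ?thesis .
qed

lemma hermitian_self: "hermitian x x = of_real ((norm x)\<^sup>2)"
  by (simp add: hermitian_def norm_vec_def L2_set_def sum_nonneg complex_norm_square[symmetric])

lemma hermitian_diff_left: "hermitian (x - y) a = hermitian x a - hermitian y a"
  by (simp add: hermitian_def algebra_simps sum_subtractf)

lemma hermitian_add_left: "hermitian (x + y) a = hermitian x a + hermitian y a"
  by (simp add: hermitian_def algebra_simps sum.distrib)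

lemma hermitian_add_right: "hermitian x (a + b) = hermitian x a + hermitian x b"
  by (simp add: hermitian_def algebra_simps sum.distrib)

lemma hermitian_scale_left: "hermitian (c *s x) a = c * hermitian x a"
  by (simp add: hermitian_def sum_distrib_left mult.assoc)

lemma hermitian_scale_right: "hermitian x (c *s a) = cnj c * hermitian x a"
  by (simp add: hermitian_def sum_distrib_left algebra_simps)

lemma hermitian_commute: "hermitian a x = cnj (hermitian x a)"
  by (simp add: hermitian_def mult.commute)

lemma norm_add_orthogonal:
  assumes "hermitian c v = 0"
  shows "(norm (c + t *s v))\<^sup>2 = (norm c)\<^sup>2 + (norm t * norm v)\<^sup>2"
proof -
  have "complex_of_real ((norm (c + t *s v))\<^sup>2) = hermitian (c + t *s v) (c + t *s v)"
    by (simp add: hermitian_self)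
  also have "\<dots> = hermitian c c + hermitian (t *s v) (t *s v)"
    using assms hermitian_commute[of v c]
    by (simp add: hermitian_add_left hermitian_add_right hermitian_scale_left
        hermitian_scale_right)
  also have "\<dots> = of_real ((norm c)\<^sup>2 + (norm t * norm v)\<^sup>2)"
    by (simp add: hermitian_self norm_vector_scaleC)
  finally show ?thesis using of_real_eq_iff by blast
qed

section \<open>Holomorphic curves\<close>

text \<open>
  Holomorphy in several variables is only ever used along complex curves, most often complex
  lines, where it reduces to holomorphy of the components.
\<close>

definition holomorphic_curve_on :: "(complex \<Rightarrow> complex ^ 'n) \<Rightarrow> complex set \<Rightarrow> bool" where
  "holomorphic_curve_on \<Gamma> S \<longleftrightarrow> (\<forall>i. (\<lambda>t. \<Gamma> t $ i) holomorphic_on S)"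

definition has_curve_derivative ::
  "(complex \<Rightarrow> complex ^ 'n) \<Rightarrow> complex ^ 'n \<Rightarrow> complex \<Rightarrow> bool" where
  "has_curve_derivative \<Gamma> d t \<longleftrightarrow> (\<forall>i. ((\<lambda>s. \<Gamma> s $ i) has_field_derivative d $ i) (at t))"

lemma holomorphic_curve_onI:
  assumes "open S" and "\<And>t. t \<in> S \<Longrightarrow> \<exists>d. has_curve_derivative \<Gamma> d t"
  shows "holomorphic_curve_on \<Gamma> S"
  using assms unfolding holomorphic_curve_on_def has_curve_derivative_def
  by (meson field_differentiable_at_within field_differentiable_def holomorphic_on_def)

lemma holomorphic_curve_onD:
  assumes "holomorphic_curve_on \<Gamma> S" "open S" "t \<in> S"
  obtains d where "has_curve_derivative \<Gamma> d t"
proof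
  show "has_curve_derivative \<Gamma> (\<chi> i. deriv (\<lambda>s. \<Gamma> s $ i) t) t"
    using assms unfolding holomorphic_curve_on_def has_curve_derivative_def
    by (auto intro!: holomorphic_derivI)
qed

lemma has_curve_derivative_imp_has_derivative:
  fixes \<Gamma> :: "complex \<Rightarrow> complex ^ 'n"
  assumes "has_curve_derivative \<Gamma> d t"
  shows "(\<Gamma> has_derivative (\<lambda>s. s *s d)) (at t)"
proof -
  have "((\<lambda>s. \<Gamma> s \<bullet> b) has_derivative (\<lambda>s. (s *s d) \<bullet> b)) (at t)" if "b \<in> Basis" for b
  proof -
    obtain i c where b: "b = axis i c" using \<open>b \<in> Basis\<close> by (auto simp: Basis_vec_def)
    have "((\<lambda>s. \<Gamma> s $ i) has_derivative (*) (d $ i)) (at t)"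
      using assms unfolding has_curve_derivative_def has_field_derivative_def by blast
    from has_derivative_inner_left[OF this, of c] show ?thesis
      by (simp add: b inner_axis mult.commute)
  qed
  then show ?thesis using has_derivative_componentwise_within by blast
qed

lemma has_curve_derivative_line: "has_curve_derivative (\<lambda>t. c + t *s v) v t"
  unfolding has_curve_derivative_def
  by (auto intro!: derivative_eq_intros)

lemma has_curve_derivative_compose:
  fixes F :: "complex ^ 'n \<Rightarrow> complex ^ 'm"
  assumes "has_curve_derivative \<Gamma> d t" and "(F has_derivative (\<lambda>v. A *v v)) (at (\<Gamma> t))"
  shows "has_curve_derivative (\<lambda>s. F (\<Gamma> s)) (A *v d) t"
proof -
  have "((\<lambda>s. F (\<Gamma> s)) has_derivative (\<lambda>s. A *v (s *s d))) (at t)"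
    using has_derivative_compose[OF has_curve_derivative_imp_has_derivative[OF assms(1)] assms(2)] .
  then have D: "((\<lambda>s. F (\<Gamma> s)) has_derivative (\<lambda>s. s *s (A *v d))) (at t)"
    by (simp add: vector_scalar_commute)
  show ?thesis
    unfolding has_curve_derivative_def has_field_derivative_def
  proof
    fix i
    show "((\<lambda>s. F (\<Gamma> s) $ i) has_derivative (*) ((A *v d) $ i)) (at t)"
      using bounded_linear.has_derivative[OF bounded_linear_vec_nth D, of i]
      by (simp add: mult.commute[of _ "(A *v d) $ i"])
  qed
qed

lemma holomorphic_curve_on_compose:
  assumes "holomorphic_map_on F T" "holomorphic_curve_on \<Gamma> S" "open S" "\<Gamma> ` S \<subseteq> T"
  shows "holomorphic_curve_on (\<lambda>t. F (\<Gamma> t)) S"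
proof (rule holomorphic_curve_onI[OF \<open>open S\<close>])
  fix t assume t: "t \<in> S"
  obtain d where "has_curve_derivative \<Gamma> d t" using holomorphic_curve_onD[OF assms(2,3) t] .
  moreover have "\<Gamma> t \<in> T" using assms(4) t by auto
  then obtain A where "(F has_derivative (\<lambda>v. A *v v)) (at (\<Gamma> t))"
    using assms(1) unfolding holomorphic_map_on_def by blast
  ultimately show "\<exists>d. has_curve_derivative (\<lambda>t. F (\<Gamma> t)) d t"
    using has_curve_derivative_compose by blast
qed

lemma holomorphic_curve_on_line: "holomorphic_curve_on (\<lambda>t. c + t *s v) S"
  unfolding holomorphic_curve_on_def by (auto intro!: holomorphic_intros)

lemma holomorphic_curve_on_diff:
  assumes "holomorphic_curve_on \<Gamma> S" "holomorphic_curve_on \<Delta> S"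
  shows "holomorphic_curve_on (\<lambda>t. \<Gamma> t - \<Delta> t) S"
  using assms unfolding holomorphic_curve_on_def by (auto intro!: holomorphic_intros)

lemma holomorphic_on_hermitian:
  assumes "holomorphic_curve_on \<Gamma> S"
  shows "(\<lambda>t. hermitian (\<Gamma> t) a) holomorphic_on S"
  using assms unfolding holomorphic_curve_on_def hermitian_def
  by (auto intro!: holomorphic_intros)

lemma has_field_derivative_hermitian:
  assumes "has_curve_derivative \<Gamma> d t"
  shows "((\<lambda>t. hermitian (\<Gamma> t) a) has_field_derivative hermitian d a) (at t)"
  using assms unfolding has_curve_derivative_def hermitian_def
  by (auto intro!: DERIV_sum DERIV_cmult_right)

section \<open>Schwarz lemma\<close>

text \<open>
  The quotient \<open>\<phi> t / t ^ k\<close> has a removable singularity at \<open>0\<close>; on the circle of radius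
  \<open>s < R\<close> it is at most \<open>B / s ^ k\<close>, and by the maximum principle also inside. Then \<open>s\<close> tends to \<open>R\<close>.
\<close>

lemma Schwarz_lemma_order:
  assumes holo: "\<phi> holomorphic_on ball 0 R"
    and bound: "\<And>t. t \<in> ball 0 R \<Longrightarrow> norm (\<phi> t) \<le> B"
    and vanish: "\<forall>\<^sub>F t in at 0. norm (\<phi> t) \<le> C * norm t ^ k"
    and t: "t \<in> ball 0 R" "t \<noteq> 0"
  shows "norm (\<phi> t) \<le> B * (norm t / R) ^ k"
proof -
  have R: "0 < R" using le_less_trans[of 0 "norm t" R] t by simp
  have "\<forall>\<^sub>F t in at 0. norm (\<phi> t / t ^ k) \<le> C"
    using vanish unfolding eventually_at_filter
    by eventually_elim (auto simp: norm_divide norm_power divide_le_eq)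
  moreover have "(\<lambda>t. \<phi> t / t ^ k) holomorphic_on ball 0 R - {0}"
    by (intro holomorphic_intros holomorphic_on_subset[OF holo]) auto
  ultimately obtain q where q: "q holomorphic_on ball 0 R"
    and q_eq: "\<And>t. t \<in> ball 0 R - {0} \<Longrightarrow> q t = \<phi> t / t ^ k"
    using holomorphic_on_extend_bounded[of "\<lambda>t. \<phi> t / t ^ k" "ball 0 R" 0] R by auto
  have q_le: "norm (q t) * s ^ k \<le> B" if s: "norm t < s" "s < R" for s
  proof -
    have s0: "0 < s" using s norm_ge_zero[of t] by linarith
    have sub: "cball 0 s \<subseteq> ball 0 R" using s by auto
    have "norm (q t) \<le> B / s ^ k"
    proof (rule maximum_modulus_frontier[of q "cball 0 s"])
      show "q holomorphic_on interior (cball 0 s)"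
        using holomorphic_on_subset[OF q] sub interior_subset by blast
      show "continuous_on (closure (cball 0 s)) q"
        using holomorphic_on_imp_continuous_on[OF holomorphic_on_subset[OF q sub]] by simp
      fix z :: complex assume "z \<in> frontier (cball 0 s)"
      then have z: "norm z = s" by auto
      then have "z \<in> ball 0 R" using s by auto
      then have "norm (q z) = norm (\<phi> z) / s ^ k" "norm (\<phi> z) \<le> B"
        using q_eq[of z] z s0 bound by (auto simp: norm_divide norm_power)
      then show "norm (q z) \<le> B / s ^ k" using s0 by (simp add: divide_right_mono)
    qed (use s in auto)
    then show ?thesis using s0 by (simp add: le_divide_eq)
  qed
  have "((\<lambda>s. norm (q t) * s ^ k) \<longlongrightarrow> norm (q t) * R ^ k) (at_left R)"
    by (intro tendsto_intros)
  then have "norm (q t) * R ^ k \<le> B"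
  proof (rule tendsto_upperbound)
    show "\<forall>\<^sub>F s in at_left R. norm (q t) * s ^ k \<le> B"
      using eventually_at_left_real[of "norm t" R] t q_le
      by (auto elim!: eventually_mono)
  qed simp
  then have "norm (q t) * norm t ^ k \<le> B / R ^ k * norm t ^ k"
    using R by (intro mult_right_mono) (simp_all add: le_divide_eq)
  moreover have "norm (\<phi> t) = norm (q t) * norm t ^ k"
    using q_eq[of t] t by (simp add: norm_divide norm_power)
  ultimately show ?thesis by (simp add: power_divide)
qed

text \<open>
  Pairing the curve with its own value \<open>\<Gamma> t\<close> reduces the vector valued case to the scalar one
  without loss in the constant.
\<close>

lemma Schwarz_lemma_curve:
  fixes \<Gamma> :: "complex \<Rightarrow> complex ^ 'n"
  assumes holo: "holomorphic_curve_on \<Gamma> (ball 0 R)"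
    and bound: "\<And>t. t \<in> ball 0 R \<Longrightarrow> norm (\<Gamma> t) \<le> B"
    and vanish: "\<forall>\<^sub>F t in at 0. norm (\<Gamma> t) \<le> C * norm t ^ k"
    and t: "t \<in> ball 0 R" "t \<noteq> 0"
  shows "norm (\<Gamma> t) \<le> B * (norm t / R) ^ k"
proof (cases "\<Gamma> t = 0")
  case True
  have "0 \<le> B" using order_trans[OF norm_ge_zero bound[OF t(1)]] .
  moreover have "0 < R" using le_less_trans[of 0 "norm t" R] t by simp
  ultimately show ?thesis using True by simp
next
  case False
  define a where "a = \<Gamma> t"
  have "norm (hermitian (\<Gamma> t) a) \<le> (B * norm a) * (norm t / R) ^ k"
  proof (rule Schwarz_lemma_order[OF holomorphic_on_hermitian[OF holo] _ _ t])
    show "norm (hermitian (\<Gamma> t) a) \<le> B * norm a" if "t \<in> ball 0 R" for t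
      using order_trans[OF hermitian_Cauchy_Schwarz mult_right_mono[OF bound[OF that] norm_ge_zero]] .
    show "\<forall>\<^sub>F t in at 0. norm (hermitian (\<Gamma> t) a) \<le> (C * norm a) * norm t ^ k"
      using vanish
    proof (eventually_elim)
      case (elim t)
      then show ?case
        using order_trans[OF hermitian_Cauchy_Schwarz mult_right_mono[OF elim norm_ge_zero]]
        by (simp only: mult.assoc mult.commute[of "norm a"])
    qed
  qed
  moreover have "norm (hermitian (\<Gamma> t) a) = norm (\<Gamma> t) * norm a"
    by (simp add: a_def hermitian_self norm_mult power2_eq_square)
  ultimately show ?thesis using False by (simp add: a_def mult_ac)
qed

text \<open>
  A Moebius transformation moves \<open>t\<close> to the centre of the disc, where Cauchy's estimate bounds the
  derivative by \<open>B\<close>. The factor \<open>R / (R\<^sup>2 - |t|\<^sup>2)\<close> is the reciprocal of the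
  derivative of the transformation there.
\<close>

lemma Schwarz_Pick_derivative:
  assumes holo: "\<phi> holomorphic_on ball 0 R"
    and bound: "\<And>t. t \<in> ball 0 R \<Longrightarrow> norm (\<phi> t) \<le> B"
    and t: "t \<in> ball 0 R"
    and deriv: "(\<phi> has_field_derivative d) (at t)"
  shows "norm d \<le> B * R / (R\<^sup>2 - (norm t)\<^sup>2)"
proof -
  have R: "0 < R" using le_less_trans[of 0 "norm t" R] t by simp
  define a where "a = t / of_real R"
  have a1: "norm a < 1" using t R by (simp add: a_def norm_divide)
  define M where "M = Moebius_function 0 (-a)"
  have M_holo: "M holomorphic_on ball 0 1" unfolding M_def
    using Moebius_function_holomorphic[of "-a" 0] a1 by simp
  have M_ball: "of_real R * M z \<in> ball 0 R" if "z \<in> ball 0 1" for z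
    using Moebius_function_norm_lt_1[of "-a" z 0] a1 that R by (simp add: M_def norm_mult)
  have M0: "of_real R * M 0 = t" using R by (simp add: M_def Moebius_function_simple a_def)
  have "(M has_field_derivative (1 - a * cnj a)) (at 0)"
    unfolding M_def Moebius_function_def by (auto intro!: derivative_eq_intros)
  then have M': "((\<lambda>z. of_real R * M z) has_field_derivative (of_real R * (1 - a * cnj a))) (at 0)"
    by (intro DERIV_cmult)
  define \<psi> where "\<psi> = (\<lambda>z. \<phi> (of_real R * M z))"
  have \<psi>': "(\<psi> has_field_derivative d * (of_real R * (1 - a * cnj a))) (at 0)"
    unfolding \<psi>_def
    by (rule DERIV_chain2[of \<phi>, OF _ M']) (use deriv M0 in simp)
  have \<psi>_holo: "\<psi> holomorphic_on ball 0 1"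
  proof -
    have "(\<lambda>z. of_real R * M z) holomorphic_on ball 0 1"
      by (intro holomorphic_on_mult holomorphic_on_const M_holo)
    moreover have "(\<lambda>z. of_real R * M z) ` ball 0 1 \<subseteq> ball 0 R" using M_ball by blast
    ultimately show ?thesis
      using holomorphic_on_compose_gen[OF _ holo] by (simp add: \<psi>_def o_def)
  qed
  have \<psi>_le: "norm (\<psi> z) \<le> B" if "z \<in> ball 0 1" for z
    using bound[OF M_ball[OF that]] by (simp add: \<psi>_def)
  have "norm (deriv \<psi> 0) * s \<le> B" if s: "0 < s" "s < 1" for s
  proof -
    have sub: "cball 0 s \<subseteq> (ball 0 1 :: complex set)" using s by auto
    have "norm ((deriv ^^ 1) \<psi> 0) \<le> fact 1 * B / s ^ 1"
    proof (rule Cauchy_inequality)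
      show "\<psi> holomorphic_on ball 0 s"
        using holomorphic_on_subset[OF \<psi>_holo] sub ball_subset_cball by blast
      show "continuous_on (cball 0 s) \<psi>"
        by (rule holomorphic_on_imp_continuous_on[OF holomorphic_on_subset[OF \<psi>_holo sub]])
      show "norm (\<psi> x) \<le> B" if "norm (0 - x) = s" for x
        using that s by (intro \<psi>_le) auto
    qed (use s in auto)
    then show ?thesis using s by (simp add: le_divide_eq)
  qed
  note * = this
  have "((\<lambda>s. norm (deriv \<psi> 0) * s) \<longlongrightarrow> norm (deriv \<psi> 0) * 1) (at_left 1)"
    by (intro tendsto_intros)
  then have "norm (deriv \<psi> 0) * 1 \<le> B"
  proof (rule tendsto_upperbound)
    show "\<forall>\<^sub>F s in at_left 1. norm (deriv \<psi> 0) * s \<le> B"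
      using eventually_at_left_real[of 0 1] * by (auto elim!: eventually_mono)
  qed simp
  moreover have "deriv \<psi> 0 = d * of_real (R * (1 - (norm a)\<^sup>2))"
    using DERIV_imp_deriv[OF \<psi>'] by (simp add: complex_norm_square[symmetric])
  moreover have "0 < R * (1 - (norm a)\<^sup>2)"
    using R a1 by (simp add: abs_square_less_1)
  ultimately have "norm d * (R * (1 - (norm a)\<^sup>2)) \<le> B"
    by (simp add: norm_mult del: of_real_mult)
  moreover have "R * (1 - (norm a)\<^sup>2) = (R\<^sup>2 - (norm t)\<^sup>2) / R"
    using R by (simp add: a_def norm_divide power_divide field_simps power2_eq_square)
  ultimately have "norm d * ((R\<^sup>2 - (norm t)\<^sup>2) / R) \<le> B" by simp
  moreover have "0 < R\<^sup>2 - (norm t)\<^sup>2" using t by (simp add: power_strict_mono)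
  ultimately show ?thesis using R by (simp add: field_simps)
qed

section \<open>Bounded holomorphic mappings of the ball\<close>

text \<open>
  Every complex line meets the ball in a round disc: if \<open>c\<close> is the foot of the perpendicular from
  the centre, the radius \<open>R\<close> satisfies \<open>R\<^sup>2 = \<rho>\<^sup>2 - |c|\<^sup>2\<close>. In the one-dimensional estimate
  on the line through \<open>z\<close> in the direction \<open>v\<close> the denominator therefore becomes
  \<open>\<rho>\<^sup>2 - |z|\<^sup>2\<close>, whatever the direction is, and the numerator only improves, as \<open>R \<le> \<rho>\<close>.
\<close>

lemma derivative_bound_ball:
  fixes F :: "complex ^ 'n \<Rightarrow> complex ^ 'm"
  assumes holo: "holomorphic_map_on F (ball 0 \<rho>)"
    and bound: "\<And>z. z \<in> ball 0 \<rho> \<Longrightarrow> norm (F z) \<le> B"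
    and z: "z \<in> ball 0 \<rho>"
    and deriv: "(F has_derivative (\<lambda>v. A *v v)) (at z)"
  shows "norm (A *v v) \<le> B * \<rho> / (\<rho>\<^sup>2 - (norm z)\<^sup>2) * norm v"
proof (cases "v = 0")
  case True then show ?thesis by simp
next
  case False
  define u where "u = of_real (1 / norm v) *s v"
  have u1: "norm u = 1" using False by (simp add: u_def norm_vector_scaleC norm_divide)
  have v_eq: "v = of_real (norm v) *s u" using False by (simp add: u_def vec_eq_iff)
  define t\<^sub>0 where "t\<^sub>0 = hermitian z u"
  define c where "c = z - t\<^sub>0 *s u"
  have orth: "hermitian c u = 0"
    by (simp add: c_def t\<^sub>0_def hermitian_diff_left hermitian_scale_left hermitian_self u1)
  have z_eq: "z = c + t\<^sub>0 *s u" by (simp add: c_def)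
  have norm_slice: "(norm (c + t *s u))\<^sup>2 = (norm c)\<^sup>2 + (norm t)\<^sup>2" for t
    using norm_add_orthogonal[OF orth] u1 by simp
  have B0: "0 \<le> B" using order_trans[OF norm_ge_zero bound[OF z]] .
  have z_lt: "(norm z)\<^sup>2 < \<rho>\<^sup>2" using z by (simp add: power_strict_mono)
  have \<rho>0: "0 < \<rho>" using le_less_trans[of 0 "norm z" \<rho>] z by simp
  define R where "R = sqrt (\<rho>\<^sup>2 - (norm c)\<^sup>2)"
  have "(norm z)\<^sup>2 = (norm c)\<^sup>2 + (norm t\<^sub>0)\<^sup>2" using norm_slice[of t\<^sub>0] z_eq by simp
  then have c_le: "(norm c)\<^sup>2 \<le> \<rho>\<^sup>2" using z_lt zero_le_power2[of "norm t\<^sub>0"] by linarith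
  then have R2: "R\<^sup>2 = \<rho>\<^sup>2 - (norm c)\<^sup>2"
    unfolding R_def by (intro real_sqrt_pow2) linarith
  have R_le: "R \<le> \<rho>" unfolding R_def using \<rho>0 by (intro real_le_lsqrt) auto
  have R0: "0 \<le> R" unfolding R_def using c_le by (intro real_sqrt_ge_zero) linarith
  have less_iff: "x < y \<longleftrightarrow> x\<^sup>2 < y\<^sup>2" if "0 \<le> x" "0 \<le> y" for x y :: real
    using that by (meson pos2 power2_less_imp_less power_strict_mono)
  have in_ball: "c + t *s u \<in> ball 0 \<rho> \<longleftrightarrow> t \<in> ball 0 R" for t
  proof -
    have "norm (c + t *s u) < \<rho> \<longleftrightarrow> (norm (c + t *s u))\<^sup>2 < \<rho>\<^sup>2"
      using \<rho>0 by (intro less_iff) auto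
    also have "\<dots> \<longleftrightarrow> (norm t)\<^sup>2 < R\<^sup>2" using norm_slice[of t] R2 by auto
    also have "\<dots> \<longleftrightarrow> norm t < R"
      using R0 by (intro less_iff[symmetric]) auto
    finally show ?thesis by simp
  qed
  define \<Gamma> where "\<Gamma> = (\<lambda>t. F (c + t *s u))"
  have \<Gamma>_holo: "holomorphic_curve_on \<Gamma> (ball 0 R)"
    unfolding \<Gamma>_def
    by (rule holomorphic_curve_on_compose[OF holo holomorphic_curve_on_line]) (use in_ball in auto)
  have \<Gamma>': "has_curve_derivative \<Gamma> (A *v u) t\<^sub>0"
    unfolding \<Gamma>_def
    by (rule has_curve_derivative_compose[OF has_curve_derivative_line]) (use deriv z_eq in simp)
  define a where "a = A *v u"
  have "norm (hermitian (A *v u) a) \<le> (B * norm a) * R / (R\<^sup>2 - (norm t\<^sub>0)\<^sup>2)"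
  proof (rule Schwarz_Pick_derivative[OF holomorphic_on_hermitian[OF \<Gamma>_holo] _ _
        has_field_derivative_hermitian[OF \<Gamma>']])
    show "norm (hermitian (\<Gamma> t) a) \<le> B * norm a" if "t \<in> ball 0 R" for t
    proof -
      have "norm (\<Gamma> t) \<le> B" unfolding \<Gamma>_def using that in_ball bound by blast
      then show ?thesis
        using hermitian_Cauchy_Schwarz[of "\<Gamma> t" a] mult_right_mono[of _ B "norm a"] by fastforce
    qed
    show "t\<^sub>0 \<in> ball 0 R" using in_ball[of t\<^sub>0] z z_eq by simp
  qed
  moreover have "norm (hermitian (A *v u) a) = norm a * norm a"
    by (simp add: a_def hermitian_self norm_mult power2_eq_square)
  moreover have "R\<^sup>2 - (norm t\<^sub>0)\<^sup>2 = \<rho>\<^sup>2 - (norm z)\<^sup>2"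
    using R2 norm_slice[of t\<^sub>0] z_eq by simp
  ultimately have le: "norm a * norm a \<le> norm a * (B * R / (\<rho>\<^sup>2 - (norm z)\<^sup>2))"
    by (simp add: mult_ac)
  have "norm a \<le> B * R / (\<rho>\<^sup>2 - (norm z)\<^sup>2)"
  proof (cases "a = 0")
    case True
    then show ?thesis using B0 R0 z_lt by simp
  next
    case False
    then show ?thesis using mult_left_le_imp_le[OF le] by simp
  qed
  also have "\<dots> \<le> B * \<rho> / (\<rho>\<^sup>2 - (norm z)\<^sup>2)"
    using divide_right_mono[OF mult_left_mono[OF R_le B0]] z_lt by simp
  finally have "norm a \<le> B * \<rho> / (\<rho>\<^sup>2 - (norm z)\<^sup>2)" .
  then have "norm v * norm a \<le> norm v * (B * \<rho> / (\<rho>\<^sup>2 - (norm z)\<^sup>2))"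
    by (rule mult_left_mono) simp
  moreover have "A *v v = of_real (norm v) *s a"
    using vector_scalar_commute[of A "of_real (norm v)" u] unfolding a_def v_eq[symmetric] .
  ultimately show ?thesis
    by (simp add: norm_vector_scaleC mult.commute[of _ "norm v"])
qed

lemma derivative_bound_smaller_ball:
  fixes F :: "complex ^ 'n \<Rightarrow> complex ^ 'm"
  assumes holo: "holomorphic_map_on F (ball 0 \<rho>)"
    and bound: "\<And>z. z \<in> ball 0 \<rho> \<Longrightarrow> norm (F z) \<le> B"
    and r: "r < \<rho>"
    and z: "z \<in> ball 0 r"
    and deriv: "(F has_derivative (\<lambda>v. A *v v)) (at z)"
  shows "norm (A *v v) \<le> B * \<rho> / (\<rho>\<^sup>2 - r\<^sup>2) * norm v"
proof -
  have r0: "0 < r" using le_less_trans[of 0 "norm z" r] z by simp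
  have zr: "(norm z)\<^sup>2 \<le> r\<^sup>2" using z by (intro power_mono) auto
  have r\<rho>: "r\<^sup>2 < \<rho>\<^sup>2" using r r0 by (intro power_strict_mono) auto
  have z\<rho>: "z \<in> ball 0 \<rho>" using z r by auto
  have B0: "0 \<le> B * \<rho>" using order_trans[OF norm_ge_zero bound[OF z\<rho>]] r r0 by simp
  have "norm (A *v v) \<le> B * \<rho> / (\<rho>\<^sup>2 - (norm z)\<^sup>2) * norm v"
    by (rule derivative_bound_ball[OF holo bound z\<rho> deriv])
  also have "\<dots> \<le> B * \<rho> / (\<rho>\<^sup>2 - r\<^sup>2) * norm v"
    using B0 zr r\<rho> by (intro mult_right_mono divide_left_mono) auto
  finally show ?thesis .
qed

lemma Lipschitz_from_derivative_bound:
  fixes F :: "complex ^ 'n \<Rightarrow> complex ^ 'm"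
  assumes "convex S"
    and deriv: "\<And>x. x \<in> S \<Longrightarrow> (F has_derivative (\<lambda>v. A x *v v)) (at x)"
    and bound: "\<And>x v. x \<in> S \<Longrightarrow> norm (A x *v v) \<le> L * norm v"
    and "x \<in> S" "y \<in> S"
  shows "norm (F x - F y) \<le> L * norm (x - y)"
proof (rule differentiable_bound[OF assms(1) _ _ assms(4,5)])
  show "(F has_derivative (\<lambda>v. A x *v v)) (at x within S)" if "x \<in> S" for x
    using deriv[OF that] by (rule has_derivative_at_withinI)
  show "onorm (\<lambda>v. A x *v v) \<le> L" if "x \<in> S" for x
    using bound[OF that] by (rule onorm_le)
qed

lemma derivative_imp_local_Lipschitz:
  assumes "(F has_derivative F') (at x)" and "\<And>v. norm (F' v) \<le> L * norm v" and "L < M"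
  shows "\<forall>\<^sub>F y in nhds x. norm (F y - F x) \<le> M * norm (y - x)"
proof -
  obtain d where d: "d > 0"
    "\<And>y. norm (y - x) < d \<Longrightarrow> norm (F y - F x - F' (y - x)) \<le> (M - L) * norm (y - x)"
    using assms(1,3) unfolding has_derivative_at_alt by (metis diff_gt_0_iff_gt)
  have "norm (F y - F x) \<le> M * norm (y - x)" if "dist y x < d" for y
  proof -
    have "norm (F y - F x) \<le> norm (F y - F x - F' (y - x)) + norm (F' (y - x))"
      by (metis norm_triangle_sub add.commute)
    also have "\<dots> \<le> (M - L) * norm (y - x) + L * norm (y - x)"
      using d(2)[of y] assms(2) that by (intro add_mono) (auto simp: dist_norm)
    finally show ?thesis by (simp add: algebra_simps)
  qed
  then show ?thesis using d(1) unfolding eventually_nhds_metric by blast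
qed

section \<open>Taylor coefficients of holomorphic curves\<close>

definition curve_coeff :: "(complex \<Rightarrow> complex ^ 'n) \<Rightarrow> nat \<Rightarrow> complex ^ 'n" where
  "curve_coeff \<Gamma> n = (\<chi> i. (deriv ^^ n) (\<lambda>t. \<Gamma> t $ i) 0 / fact n)"

lemma vec_sumsI: "(\<And>i. (\<lambda>n. f n $ i) sums (a $ i)) \<Longrightarrow> f sums a"
  unfolding sums_def by (rule vec_tendstoI) simp

lemma curve_power_series:
  assumes "holomorphic_curve_on \<Gamma> (ball 0 R)" "t \<in> ball 0 R"
  shows "(\<lambda>n. t ^ n *s curve_coeff \<Gamma> n) sums \<Gamma> t"
proof (rule vec_sumsI)
  fix i
  have "(\<lambda>n. (deriv ^^ n) (\<lambda>t. \<Gamma> t $ i) 0 / fact n * (t - 0) ^ n) sums (\<Gamma> t $ i)"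
    using assms unfolding holomorphic_curve_on_def by (intro holomorphic_power_series) auto
  then show "(\<lambda>n. (t ^ n *s curve_coeff \<Gamma> n) $ i) sums (\<Gamma> t $ i)"
    by (simp add: curve_coeff_def mult.commute)
qed

lemma curve_coeff_0 [simp]: "curve_coeff \<Gamma> 0 = \<Gamma> 0"
  by (simp add: curve_coeff_def vec_eq_iff)

lemma curve_coeff_1: "has_curve_derivative \<Gamma> d 0 \<Longrightarrow> curve_coeff \<Gamma> 1 = d"
  unfolding has_curve_derivative_def curve_coeff_def
  by (auto simp: vec_eq_iff intro: DERIV_imp_deriv)

text \<open>
  Dividing the power series by \<open>t ^ k\<close> leaves a power series, whose sum is continuous at \<open>0\<close>.
\<close>

lemma curve_Taylor_quotient_limit:
  fixes \<Gamma> :: "complex \<Rightarrow> complex ^ 'n"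
  assumes series: "\<And>t. t \<in> ball 0 R \<Longrightarrow> (\<lambda>n. t ^ n *s c n) sums \<Gamma> t" and "0 < R"
    and vanish: "\<And>n. n < k \<Longrightarrow> c n = 0"
  shows "((\<lambda>t. (1 / t ^ k) *s \<Gamma> t) \<longlongrightarrow> c k) (at 0)"
proof (rule vec_tendstoI)
  fix i
  define q where "q = (\<lambda>t. if t = 0 then c k $ i else \<Gamma> t $ i / t ^ k)"
  have "q holomorphic_on ball 0 R"
  proof (rule power_series_holomorphic[where a = "\<lambda>n. c (n + k) $ i"])
    fix t :: complex assume t: "t \<in> ball 0 R"
    show "(\<lambda>n. c (n + k) $ i * (t - 0) ^ n) sums q t"
    proof (cases "t = 0")
      case True
      then show ?thesis using powser_sums_zero[of "\<lambda>n. c (n + k) $ i"] by (simp add: q_def)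
    next
      case False
      have "(\<lambda>n. t ^ n * c n $ i) sums (\<Gamma> t $ i)"
        using sums_vec_nth[OF series[OF t], of i] by simp
      then have "(\<lambda>n. t ^ (n + k) * c (n + k) $ i) sums (\<Gamma> t $ i)"
        using sums_iff_shift[of "\<lambda>n. t ^ n * c n $ i" k "\<Gamma> t $ i"] vanish by simp
      then have "(\<lambda>n. t ^ (n + k) * c (n + k) $ i / t ^ k) sums (\<Gamma> t $ i / t ^ k)"
        by (rule sums_divide)
      then show ?thesis using False by (simp add: q_def power_add mult_ac)
    qed
  qed
  then have "isCont q 0"
    using \<open>0 < R\<close> by (meson centre_in_ball continuous_on_eq_continuous_at
        holomorphic_on_imp_continuous_on open_ball)
  then have "q \<midarrow>0\<rightarrow> c k $ i" by (simp add: isCont_def q_def)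
  moreover have "\<forall>\<^sub>F t in at 0. q t = ((1 / t ^ k) *s \<Gamma> t) $ i"
    by (auto simp: eventually_at_filter q_def)
  ultimately show "((\<lambda>t. ((1 / t ^ k) *s \<Gamma> t) $ i) \<longlongrightarrow> c k $ i) (at 0)"
    by (rule Lim_transform_eventually)
qed

lemma curve_Taylor_remainder:
  assumes holo: "holomorphic_curve_on \<Gamma> (ball 0 1)" and t: "t \<in> ball 0 1"
    and coeff: "\<And>n. m \<le> n \<Longrightarrow> norm (curve_coeff \<Gamma> n) \<le> 1"
  shows "norm (\<Gamma> t - (\<Sum>n<m. t ^ n *s curve_coeff \<Gamma> n)) \<le> norm t ^ m / (1 - norm t)"
proof -
  define f where "f = (\<lambda>n. t ^ n *s curve_coeff \<Gamma> n)"
  have "(\<lambda>n. f (n + m)) sums (\<Gamma> t - (\<Sum>n<m. f n))"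
    using curve_power_series[OF holo t] unfolding f_def by (rule sums_split_initial_segment)
  moreover have "(\<lambda>n. norm t ^ m * norm t ^ n) sums (norm t ^ m * (1 / (1 - norm t)))"
    using t by (intro sums_mult geometric_sums) auto
  moreover have "norm (f (n + m)) \<le> norm t ^ m * norm t ^ n" for n
    using mult_left_mono[OF coeff[of "n + m"], of "norm t ^ (n + m)"]
    by (simp add: f_def norm_vector_scaleC norm_mult norm_power power_add mult.commute)
  ultimately have "norm (\<Gamma> t - (\<Sum>n<m. f n)) \<le> norm t ^ m * (1 / (1 - norm t))"
    by (metis norm_suminf_le sums_iff)
  then show ?thesis by (simp add: f_def)
qed

lemma curve_vanishing_order_bound:
  fixes \<Gamma> :: "complex \<Rightarrow> complex ^ 'n"
  assumes lim: "((\<lambda>t. (1 / t ^ k) *s \<Gamma> t) \<longlongrightarrow> c) (at 0)" and "norm c < C"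
  shows "\<forall>\<^sub>F t in at 0. norm (\<Gamma> t) \<le> C * norm t ^ k"
proof -
  have "\<forall>\<^sub>F t in at 0. norm ((1 / t ^ k) *s \<Gamma> t) < C"
    using order_tendstoD(2)[OF tendsto_norm[OF lim] assms(2)] .
  moreover have "\<forall>\<^sub>F t in at (0::complex). t \<noteq> 0" by (simp add: eventually_at_filter)
  ultimately show ?thesis
    by eventually_elim
       (simp add: norm_vector_scaleC norm_divide norm_power divide_less_eq)
qed

section \<open>Holomorphic mappings with a critical point\<close>

text \<open>
  The gain of a factor of the size of \<open>z\<close> and \<open>w\<close> over the Lipschitz bound comes from the curve
  \<open>t \<mapsto> G (t z) - G (t w)\<close>. It vanishes to second order at \<open>0\<close> because \<open>0\<close> is a critical point, and
  on the disc of radius \<open>R = r / max |z| |w|\<close> it is bounded by \<open>R L |z - w|\<close>. The Schwarz lemma of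
  order two, evaluated at \<open>t = 1\<close>, gives the quotient of this bound by \<open>R\<^sup>2\<close>.
  Working with differences avoids the holomorphy of the derivative of \<open>G\<close>.
\<close>

lemma difference_bound_of_critical_point:
  fixes G :: "complex ^ 'n \<Rightarrow> complex ^ 'm"
  assumes holo: "holomorphic_map_on G (ball 0 r)"
    and Lip: "\<And>x y. x \<in> ball 0 r \<Longrightarrow> y \<in> ball 0 r \<Longrightarrow> norm (G x - G y) \<le> L * norm (x - y)"
    and crit: "(G has_derivative (\<lambda>v. 0)) (at 0)"
    and z: "z \<in> ball 0 r" and w: "w \<in> ball 0 r"
  shows "norm (G z - G w) \<le> L / r * max (norm z) (norm w) * norm (z - w)"
proof (cases "z = w")
  case True then show ?thesis by simp
next
  case False
  define m where "m = max (norm z) (norm w)"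
  have m0: "0 < m" using False unfolding m_def by (metis less_max_iff_disj zero_less_norm_iff)
  have mr: "m < r" using z w by (simp add: m_def)
  define R where "R = r / m"
  have R1: "1 < R" using m0 mr by (simp add: R_def)
  define \<Gamma> where "\<Gamma> = (\<lambda>t. G (0 + t *s z) - G (0 + t *s w))"
  have in_ball: "t *s x \<in> ball 0 r" if "t \<in> ball 0 R" "norm x \<le> m" for t and x :: "complex ^ 'n"
  proof -
    have "norm (t *s x) \<le> norm t * m"
      using that by (simp add: norm_vector_scaleC mult_left_mono)
    also have "\<dots> < R * m" using that m0 by simp
    finally show ?thesis using m0 by (simp add: R_def)
  qed
  have zm: "norm z \<le> m" and wm: "norm w \<le> m" by (simp_all add: m_def)
  have \<Gamma>_holo: "holomorphic_curve_on \<Gamma> (ball 0 R)"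
    unfolding \<Gamma>_def
    by (intro holomorphic_curve_on_diff holomorphic_curve_on_compose[OF holo holomorphic_curve_on_line])
       (use in_ball zm wm in auto)
  have \<Gamma>_Lip: "norm (\<Gamma> t) \<le> norm t * (L * norm (z - w))" if "t \<in> ball 0 R" for t
  proof -
    have "norm (\<Gamma> t) \<le> L * norm (t *s z - t *s w)"
      unfolding \<Gamma>_def using Lip[OF in_ball[OF that zm] in_ball[OF that wm]] by simp
    also have "\<dots> = norm t * (L * norm (z - w))"
      by (simp only: vector_ssub_ldistrib[symmetric] norm_vector_scaleC mult_ac)
    finally show ?thesis .
  qed
  have L0: "0 \<le> L * norm (z - w)"
    using order_trans[OF norm_ge_zero \<Gamma>_Lip[of 1]] R1 by simp
  have crit_A: "(G has_derivative (\<lambda>v. (0 :: complex^'n^'m) *v v)) (at 0)"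
    using crit by simp
  have \<Gamma>': "has_curve_derivative \<Gamma> 0 0"
  proof -
    have "has_curve_derivative (\<lambda>t. G (0 + t *s x)) 0 0" for x
      using has_curve_derivative_compose[OF has_curve_derivative_line[of 0 x 0], of G 0] crit_A
      by simp
    from this[of z] this[of w] show ?thesis
      unfolding \<Gamma>_def has_curve_derivative_def
      by (auto intro!: derivative_eq_intros)
  qed
  have series: "(\<lambda>n. t ^ n *s curve_coeff \<Gamma> n) sums \<Gamma> t" if "t \<in> ball 0 R" for t
    using curve_power_series[OF \<Gamma>_holo that] .
  have "curve_coeff \<Gamma> n = 0" if "n < 2" for n
  proof -
    have "n = 0 \<or> n = 1" using that by auto
    then show ?thesis using curve_coeff_1[OF \<Gamma>'] by (auto simp: \<Gamma>_def)
  qed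
  then have "((\<lambda>t. (1 / t ^ 2) *s \<Gamma> t) \<longlongrightarrow> curve_coeff \<Gamma> 2) (at 0)"
    using R1 by (intro curve_Taylor_quotient_limit[OF series]) auto
  then have vanish: "\<forall>\<^sub>F t in at 0. norm (\<Gamma> t) \<le> (norm (curve_coeff \<Gamma> 2) + 1) * norm t ^ 2"
    by (rule curve_vanishing_order_bound) simp
  have "norm (\<Gamma> 1) \<le> (R * (L * norm (z - w))) * (norm (1::complex) / R) ^ 2"
  proof (rule Schwarz_lemma_curve[OF \<Gamma>_holo _ vanish])
    show "norm (\<Gamma> t) \<le> R * (L * norm (z - w))" if "t \<in> ball 0 R" for t
      by (rule order_trans[OF \<Gamma>_Lip[OF that]]) (use that L0 in \<open>auto intro!: mult_right_mono\<close>)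
  qed (use R1 in auto)
  also have "\<dots> = L / r * m * norm (z - w)"
    using m0 mr by (simp add: R_def power2_eq_square field_simps)
  finally show ?thesis by (simp add: \<Gamma>_def m_def)
qed

section \<open>Averages over roots of unity\<close>

definition root_of_unity :: "nat \<Rightarrow> nat \<Rightarrow> complex" where
  "root_of_unity k j = exp (2 * of_real pi * \<i> * of_nat j / of_nat k)"

definition root_average :: "nat \<Rightarrow> (complex \<Rightarrow> complex ^ 'n) \<Rightarrow> complex \<Rightarrow> complex ^ 'n" where
  "root_average k \<Gamma> t = (\<Sum>j<k. (1 / of_nat k) *\<^sub>R \<Gamma> (root_of_unity k j * t))"

lemma norm_root_of_unity [simp]: "norm (root_of_unity k j) = 1"
  by (simp add: root_of_unity_def)

lemma sum_powers_roots_of_unity: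
  assumes "0 < k"
  shows "(\<Sum>j<k. root_of_unity k j ^ n) = (if k dvd n then of_nat k else 0)"
proof -
  have swap: "root_of_unity k j ^ n = root_of_unity k n ^ j" for j
    by (simp add: root_of_unity_def mult_ac flip: exp_of_nat_mult)
  have "root_of_unity k n = 1 \<longleftrightarrow> k dvd n"
    using complex_root_unity_eq[of k n 0] assms
    by (simp add: root_of_unity_def dvd_eq_mod_eq_0)
  moreover have "root_of_unity k n ^ k = 1"
    using complex_root_unity[of k n] assms by (simp add: root_of_unity_def)
  ultimately show ?thesis
    by (auto simp: swap geometric_sum)
qed

lemma root_average_in_convex:
  assumes "convex C" "0 < k" "\<And>s. norm s = norm t \<Longrightarrow> \<Gamma> s \<in> C"
  shows "root_average k \<Gamma> t \<in> C"
  unfolding root_average_def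
  by (rule convex_sum) (use assms in \<open>auto simp: norm_mult\<close>)

text \<open>
  Averaging over the rotations by the \<open>k\<close>-th roots of unity erases all Taylor coefficients whose
  index is not a multiple of \<open>k\<close>.
\<close>

lemma root_average_series:
  fixes \<Gamma> :: "complex \<Rightarrow> complex ^ 'n"
  assumes holo: "holomorphic_curve_on \<Gamma> (ball 0 R)" and t: "t \<in> ball 0 R" and "0 < k"
  shows "(\<lambda>n. t ^ n *s (if k dvd n then curve_coeff \<Gamma> n else 0)) sums root_average k \<Gamma> t"
proof -
  have "(\<lambda>n. (root_of_unity k j * t) ^ n *s curve_coeff \<Gamma> n) sums \<Gamma> (root_of_unity k j * t)" for j
    using t by (intro curve_power_series[OF holo]) (simp add: norm_mult)
  then have "(\<lambda>n. \<Sum>j<k. (1 / of_nat k) *\<^sub>R ((root_of_unity k j * t) ^ n *s curve_coeff \<Gamma> n))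
      sums root_average k \<Gamma> t"
    unfolding root_average_def by (intro sums_sum sums_scaleR_right)
  moreover have "(\<Sum>j<k. (1 / of_nat k) *\<^sub>R ((root_of_unity k j * t) ^ n *s curve_coeff \<Gamma> n))
      = t ^ n *s (if k dvd n then curve_coeff \<Gamma> n else 0)" for n
  proof -
    have "(\<Sum>j<k. (1 / of_nat k) *\<^sub>R ((root_of_unity k j * t) ^ n *s curve_coeff \<Gamma> n)) $ i
        = (\<Sum>j<k. root_of_unity k j ^ n) * (t ^ n * curve_coeff \<Gamma> n $ i / of_nat k)" for i
      by (simp add: sum_distrib_left sum_divide_distrib power_mult_distrib
          scaleR_conv_of_real[where 'a = complex] mult_ac)
    then show ?thesis
      using \<open>0 < k\<close> by (simp add: vec_eq_iff sum_powers_roots_of_unity)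
  qed
  ultimately show ?thesis by simp
qed

lemma holomorphic_curve_on_series:
  assumes "\<And>t. t \<in> ball 0 R \<Longrightarrow> (\<lambda>n. t ^ n *s c n) sums \<Gamma> t"
  shows "holomorphic_curve_on \<Gamma> (ball 0 R)"
  unfolding holomorphic_curve_on_def
proof
  fix i
  show "(\<lambda>t. \<Gamma> t $ i) holomorphic_on ball 0 R"
    by (rule power_series_holomorphic[where a = "\<lambda>n. c n $ i"])
       (use sums_vec_nth[OF assms, of _ i] in \<open>simp add: mult.commute\<close>)
qed

lemma holomorphic_curve_on_imp_isCont:
  assumes "holomorphic_curve_on \<Gamma> S" "open S" "t \<in> S"
  shows "isCont \<Gamma> t"
proof -
  obtain d where "has_curve_derivative \<Gamma> d t" using holomorphic_curve_onD[OF assms] .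
  then show ?thesis
    by (rule has_derivative_continuous[OF has_curve_derivative_imp_has_derivative])
qed

section \<open>Growth of convex mappings\<close>

text \<open>
  This is the several variable form of the bound \<open>|a\<^sub>k| \<le> 1\<close> for the coefficients of a normalized
  convex function. By convexity the average \<open>P\<close> of \<open>t \<mapsto> h (t u)\<close> over \<open>k\<close>-th roots of unity stays
  in the image of \<open>h\<close>, so \<open>G\<close>, the composition of the inverse of \<open>h\<close> with \<open>P\<close>, maps the
  disc into the unit ball. As \<open>P t - h 0 = c\<^sub>k t ^ k + \<dots>\<close>, the curve \<open>G\<close> vanishes to order \<open>k\<close>, and the
  Schwarz lemma gives \<open>|G t| \<le> |t| ^ k\<close>. The derivative of \<open>h\<close> at \<open>0\<close> is
  the identity and \<open>h (G t) = P t\<close>, so \<open>P t - h 0\<close> is asymptotically as large as \<open>G t\<close>, whence \<open>|c\<^sub>k| \<le> 1\<close>.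
\<close>

lemma convex_map_coeff_bound:
  fixes h :: "complex ^ 'n \<Rightarrow> complex ^ 'n"
  assumes h_holo: "holomorphic_map_on h (ball 0 1)"
    and h_convex: "convex (h ` ball 0 1)"
    and inv_holo: "holomorphic_map_on hi (h ` ball 0 1)"
    and inv: "\<And>z. z \<in> ball 0 1 \<Longrightarrow> hi (h z) = z"
    and h'0: "(h has_derivative (\<lambda>v. v)) (at 0)"
    and u: "norm u = 1" and k: "0 < k"
  shows "norm (curve_coeff (\<lambda>t. h (t *s u)) k) \<le> 1"
proof -
  define \<Gamma> where "\<Gamma> = (\<lambda>t. h (t *s u))"
  define c where "c = curve_coeff \<Gamma>"
  define P where "P = root_average k \<Gamma>"
  define G where "G = (\<lambda>t. hi (P t))"
  have line: "t *s u \<in> ball 0 1 \<longleftrightarrow> t \<in> ball 0 1" for t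
    by (simp add: norm_vector_scaleC u)
  have \<Gamma>_holo: "holomorphic_curve_on \<Gamma> (ball 0 1)"
    unfolding \<Gamma>_def
    by (rule holomorphic_curve_on_compose[OF h_holo])
       (use holomorphic_curve_on_line[of 0 u] line in auto)
  have P_series: "(\<lambda>n. t ^ n *s (if k dvd n then c n else 0)) sums P t" if "t \<in> ball 0 1" for t
    unfolding P_def c_def by (rule root_average_series[OF \<Gamma>_holo that k])
  have P_holo: "holomorphic_curve_on P (ball 0 1)"
    by (rule holomorphic_curve_on_series[OF P_series])
  have P_in: "P t \<in> h ` ball 0 1" if "t \<in> ball 0 1" for t
    unfolding P_def
    by (rule root_average_in_convex[OF h_convex k]) (use that line in \<open>auto simp: \<Gamma>_def\<close>)
  have G_ball: "G t \<in> ball 0 1" "h (G t) = P t" if "t \<in> ball 0 1" for t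
    using P_in[OF that] inv by (auto simp: G_def)
  have G_holo: "holomorphic_curve_on G (ball 0 1)"
    unfolding G_def using P_in by (intro holomorphic_curve_on_compose[OF inv_holo P_holo]) auto
  have P0: "P 0 = h 0" using k
    by (simp add: P_def root_average_def \<Gamma>_def sum_constant_scaleR del: sum_constant)
  have G0: "G 0 = 0" using inv[of 0] by (simp add: G_def P0)
  have P_lim: "(P \<longlongrightarrow> h 0) (at 0)" and G_lim: "(G \<longlongrightarrow> 0) (at 0)"
    using holomorphic_curve_on_imp_isCont[OF P_holo, of 0]
      holomorphic_curve_on_imp_isCont[OF G_holo, of 0] P0 G0 by (auto simp: isCont_def)
  define d where "d = (\<lambda>n. if n \<noteq> 0 \<and> k dvd n then c n else 0)"
  have diff_series: "(\<lambda>n. t ^ n *s d n) sums (P t - h 0)" if "t \<in> ball 0 1" for t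
  proof -
    have "(\<lambda>n. if n = 0 then h 0 else 0) sums h 0"
      using sums_single[of 0 "\<lambda>_. h 0"] by simp
    note sums_diff[OF P_series[OF that] this]
    moreover have "t ^ n *s (if k dvd n then c n else 0) - (if n = 0 then h 0 else 0) = t ^ n *s d n" for n
      by (simp add: d_def c_def \<Gamma>_def)
    ultimately show ?thesis by simp
  qed
  have lim: "((\<lambda>t. (1 / t ^ k) *s (P t - h 0)) \<longlongrightarrow> c k) (at 0)"
  proof -
    have "d n = 0" if "n < k" for n using that by (auto simp: d_def dest: dvd_imp_le)
    then have "((\<lambda>t. (1 / t ^ k) *s (P t - h 0)) \<longlongrightarrow> d k) (at 0)"
      by (intro curve_Taylor_quotient_limit[where R = 1] diff_series) simp_all
    then show ?thesis using k by (simp add: d_def)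
  qed
  define C where "C = norm (c k) + 1"
  have P_vanish: "\<forall>\<^sub>F t in at 0. norm (P t - h 0) \<le> C * norm t ^ k"
    by (rule curve_vanishing_order_bound[OF lim]) (simp add: C_def)
  have "h 0 \<in> h ` ball 0 1" by (intro imageI) simp
  then obtain A where A: "(hi has_derivative (\<lambda>v. A *v v)) (at (h 0))"
    using inv_holo unfolding holomorphic_map_on_def by blast
  define M where "M = onorm (\<lambda>v. A *v v) + 1"
  have M0: "0 \<le> M" by (simp add: M_def add_nonneg_nonneg onorm_pos_le)
  have "\<forall>\<^sub>F y in nhds (h 0). norm (hi y - hi (h 0)) \<le> M * norm (y - h 0)"
    by (rule derivative_imp_local_Lipschitz[OF A onorm]) (auto simp: M_def)
  from eventually_compose_filterlim[OF this P_lim]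
  have "\<forall>\<^sub>F t in at 0. norm (G t) \<le> M * norm (P t - h 0)"
    using inv[of 0] by (simp add: G_def)
  then have G_vanish: "\<forall>\<^sub>F t in at 0. norm (G t) \<le> (M * C) * norm t ^ k"
    using P_vanish
  proof eventually_elim
    case (elim t)
    show ?case
      using order_trans[OF elim(1) mult_left_mono[OF elim(2) M0]] by (simp add: mult.assoc)
  qed
  have G_le: "norm (G t) \<le> norm t ^ k" if "t \<in> ball 0 1" "t \<noteq> 0" for t
    using Schwarz_lemma_curve[OF G_holo _ G_vanish that, of 1] G_ball(1) by (simp add: less_imp_le)
  \<comment> \<open>The slack \<open>e\<close> absorbs the error in \<open>h x - h 0 \<approx> x\<close> for small \<open>x\<close>.\<close>
  have "norm (c k) \<le> 1 + e" if "0 < e" for e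
  proof -
    have "\<forall>\<^sub>F x in nhds 0. norm (h x - h 0) \<le> (1 + e) * norm (x - 0)"
      using derivative_imp_local_Lipschitz[OF h'0, of 1 "1 + e"] that by simp
    from eventually_compose_filterlim[OF this G_lim]
    have "\<forall>\<^sub>F t in at 0. norm (h (G t) - h 0) \<le> (1 + e) * norm (G t)"
      by simp
    moreover have "\<forall>\<^sub>F t in at (0::complex). t \<in> ball 0 1 - {0}"
      using eventually_at_ball'[of 1 "0::complex" UNIV] by simp
    ultimately have "\<forall>\<^sub>F t in at 0. norm ((1 / t ^ k) *s (P t - h 0)) \<le> 1 + e"
    proof eventually_elim
      case (elim t)
      have "norm (P t - h 0) \<le> (1 + e) * norm t ^ k"
        using order_trans[OF elim(1) mult_left_mono[OF G_le[of t], of "1 + e"]] elim(2) that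
          G_ball(2)[of t] by simp
      moreover have "norm ((1 / t ^ k) *s (P t - h 0)) = norm (P t - h 0) / norm t ^ k"
        by (simp only: norm_vector_scaleC norm_divide norm_power norm_one times_divide_eq_left mult_1)
      ultimately show ?case using elim(2) by (simp add: divide_le_eq)
    qed
    then show ?thesis
      by (rule tendsto_upperbound[OF tendsto_norm[OF lim]]) simp
  qed
  then have "norm (c k) \<le> 1" by (rule field_le_epsilon)
  then show ?thesis by (simp add: c_def \<Gamma>_def)
qed

text \<open>
  On the complex line through \<open>z\<close>, the coefficient bounds dominate the Taylor series of \<open>h\<close>
  by a geometric series.
\<close>

lemma convex_map_growth:
  fixes h :: "complex ^ 'n \<Rightarrow> complex ^ 'n"
  assumes h_holo: "holomorphic_map_on h (ball 0 1)"
    and h_convex: "convex (h ` ball 0 1)"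
    and inv_holo: "holomorphic_map_on hi (h ` ball 0 1)"
    and inv: "\<And>z. z \<in> ball 0 1 \<Longrightarrow> hi (h z) = z"
    and h'0: "(h has_derivative (\<lambda>v. v)) (at 0)"
    and z: "z \<in> ball 0 1"
  shows "norm (h z - h 0) \<le> norm z / (1 - norm z)"
    and "norm (h z - h 0 - z) \<le> (norm z)\<^sup>2 / (1 - norm z)"
proof -
  obtain u :: "complex ^ 'n" where u: "norm u = 1" and z_eq: "z = of_real (norm z) *s u"
  proof (cases "z = 0")
    case True
    obtain e :: "complex ^ 'n" where e: "norm e = 1" using vector_choose_size[of 1] by auto
    show ?thesis by (rule that[OF e]) (simp add: True)
  next
    case False
    show ?thesis
    proof (rule that)
      show "norm (of_real (1 / norm z) *s z) = 1"
        using False by (simp add: norm_vector_scaleC norm_divide)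
      show "z = of_real (norm z) *s (of_real (1 / norm z) *s z)"
        using False by (simp add: vec_eq_iff)
    qed
  qed
  define \<Gamma> where "\<Gamma> = (\<lambda>t. h (t *s u))"
  have \<Gamma>_holo: "holomorphic_curve_on \<Gamma> (ball 0 1)"
    unfolding \<Gamma>_def
    by (rule holomorphic_curve_on_compose[OF h_holo])
       (use holomorphic_curve_on_line[of 0 u] u in \<open>auto simp: norm_vector_scaleC\<close>)
  have coeff: "norm (curve_coeff \<Gamma> n) \<le> 1" if "1 \<le> n" for n
    unfolding \<Gamma>_def
    using convex_map_coeff_bound[OF h_holo h_convex inv_holo inv h'0 u, of n] that by simp
  have rz: "complex_of_real (norm z) \<in> ball 0 1" using z by simp
  have "has_curve_derivative \<Gamma> u 0"
    unfolding \<Gamma>_def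
    using has_curve_derivative_compose[OF has_curve_derivative_line[of 0 u 0], of h "mat 1"] h'0
    by simp
  then have c1: "curve_coeff \<Gamma> (Suc 0) = u" using curve_coeff_1 by simp
  have \<Gamma>z: "\<Gamma> (of_real (norm z)) = h z" using z_eq by (simp add: \<Gamma>_def)
  have c0: "curve_coeff \<Gamma> 0 = h 0" by (simp add: \<Gamma>_def)
  show "norm (h z - h 0) \<le> norm z / (1 - norm z)"
    using curve_Taylor_remainder[OF \<Gamma>_holo rz, of 1] coeff \<Gamma>z c0
    by (simp del: curve_coeff_0)
  show "norm (h z - h 0 - z) \<le> (norm z)\<^sup>2 / (1 - norm z)"
    using curve_Taylor_remainder[OF \<Gamma>_holo rz, of 2] coeff \<Gamma>z c0 c1 z_eq
    by (simp del: curve_coeff_0 add: numeral_2_eq_2 diff_diff_eq)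
qed

section \<open>Perturbations of the identity\<close>

text \<open>
  Adding up the hypothesis over \<open>N\<close> equal pieces of the segment from \<open>0\<close> to \<open>x\<close> is a Riemann sum for
  \<open>\<integral> K s ds\<close> over \<open>[0, |x|]\<close>; the limit \<open>N \<rightarrow> \<infinity>\<close> halves the constant that a single step would
  give. This factor is the \<open>1/2\<close> in the radius of the univalent ball.
\<close>

lemma quadratic_bound_of_local_Lipschitz:
  fixes e :: "'a::real_normed_vector \<Rightarrow> 'b::real_normed_vector"
  assumes e0: "e 0 = 0" and K: "0 \<le> K"
    and Lip: "\<And>x y. x \<in> cball 0 r \<Longrightarrow> y \<in> cball 0 r \<Longrightarrow>
      norm (e x - e y) \<le> K * max (norm x) (norm y) * norm (x - y)"
    and x: "x \<in> cball 0 r"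
  shows "norm (e x) \<le> K * (norm x)\<^sup>2 / 2"
proof -
  have bound: "norm (e x) \<le> K * (norm x)\<^sup>2 / 2 * (1 + 1 / real N)" if N: "0 < N" for N :: nat
  proof -
    define p where "p = (\<lambda>j::nat. (real j / real N) *\<^sub>R x)"
    have p_norm: "norm (p j) = real j / real N * norm x" for j by (simp add: p_def)
    have p_in: "p j \<in> cball 0 r" if "j \<le> N" for j
    proof -
      have "real j / real N * norm x \<le> 1 * norm x"
        using that N by (intro mult_right_mono) auto
      then show ?thesis using x p_norm[of j] by simp
    qed
    have step: "norm (e (p (Suc j)) - e (p j)) \<le> K * (norm x)\<^sup>2 / (real N)\<^sup>2 * real (Suc j)"
      if "j < N" for j
    proof -
      have "norm (p j) \<le> norm (p (Suc j))"
        unfolding p_norm by (intro mult_right_mono divide_right_mono) auto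
      moreover have "p (Suc j) - p j = (1 / real N) *\<^sub>R x"
        by (simp add: p_def add_divide_distrib flip: scaleR_left_diff_distrib)
      ultimately have "norm (e (p (Suc j)) - e (p j)) \<le> K * norm (p (Suc j)) * (1 / real N * norm x)"
        using Lip[of "p (Suc j)" "p j"] p_in that by (simp add: max_absorb1)
      also have "\<dots> = K * (norm x)\<^sup>2 / (real N)\<^sup>2 * real (Suc j)"
        by (simp add: p_norm power2_eq_square)
      finally show ?thesis .
    qed
    have "e x = (\<Sum>j<N. e (p (Suc j)) - e (p j))"
      using sum_lessThan_telescope[of "\<lambda>j. e (p j)" N] N e0 by (simp add: p_def)
    then have "norm (e x) \<le> (\<Sum>j<N. K * (norm x)\<^sup>2 / (real N)\<^sup>2 * real (Suc j))"
      using step by (auto intro!: sum_norm_le)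
    also have "\<dots> = K * (norm x)\<^sup>2 / (real N)\<^sup>2 * (\<Sum>j<N. real (Suc j))"
      by (simp add: sum_distrib_left)
    also have "(\<Sum>j<N. real (Suc j)) = real N * (real N + 1) / 2"
      by (induction N) (auto simp: field_simps)
    also have "K * (norm x)\<^sup>2 / (real N)\<^sup>2 * (real N * (real N + 1) / 2)
        = K * (norm x)\<^sup>2 / 2 * (1 + 1 / real N)"
      using N by (simp add: power2_eq_square field_simps)
    finally show ?thesis .
  qed
  have "(\<lambda>N. K * (norm x)\<^sup>2 / 2 * (1 + 1 / real N)) \<longlonglongrightarrow> K * (norm x)\<^sup>2 / 2 * (1 + 0)"
    by (intro tendsto_intros lim_1_over_n)
  then have "norm (e x) \<le> K * (norm x)\<^sup>2 / 2 * (1 + 0)"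
    by (rule LIMSEQ_le_const) (use bound in \<open>auto intro!: exI[of _ 1]\<close>)
  then show ?thesis by simp
qed

text \<open>
  Injectivity holds because \<open>e\<close> contracts distances between any two points of the open ball. A
  solution of \<open>x + e x = y\<close> is a fixed point of \<open>x \<mapsto> y - e x\<close>. By the quadratic bound \<open>e\<close> is at
  most \<open>1 / (2 K)\<close> on the closed ball, so for \<open>|y| < 1 / (2 K)\<close> this mapping sends the closed ball of
  radius \<open>1 / K\<close> into its interior, and Brouwer's theorem applies. By invariance of domain the
  inverse is continuous, so the preimage of the small ball is connected.
\<close>

lemma perturbed_identity_univalent:
  fixes e :: "'a::euclidean_space \<Rightarrow> 'a"
  assumes K: "0 < K" and e0: "e 0 = 0"
    and Lip: "\<And>x y. x \<in> cball 0 (1 / K) \<Longrightarrow> y \<in> cball 0 (1 / K) \<Longrightarrow>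
      norm (e x - e y) \<le> K * max (norm x) (norm y) * norm (x - y)"
  shows "inj_on (\<lambda>x. x + e x) (ball 0 (1 / K))"
    and "\<exists>V \<subseteq> ball 0 (1 / K). open V \<and> connected V \<and>
      bij_betw (\<lambda>x. x + e x) V (ball 0 (1 / (2 * K)))"
proof -
  define f where "f = (\<lambda>x. x + e x)"
  have inj: "inj_on f (ball 0 (1 / K))"
  proof (rule inj_onI, rule ccontr)
    fix x y assume xy: "x \<in> ball 0 (1 / K)" "y \<in> ball 0 (1 / K)" "f x = f y" "x \<noteq> y"
    have "norm (x - y) = norm (e x - e y)"
      using xy(3) by (metis (no_types, opaque_lifting) f_def add_diff_cancel_left' add_diff_eq
          diff_add_cancel diff_diff_eq2 norm_minus_commute)
    also have "\<dots> \<le> K * max (norm x) (norm y) * norm (x - y)"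
      using Lip[of x y] xy by simp
    also have "\<dots> < 1 * norm (x - y)"
      using xy K by (intro mult_strict_right_mono) (auto simp: max_def field_simps)
    finally show False by simp
  qed
  then show "inj_on (\<lambda>x. x + e x) (ball 0 (1 / K))" by (simp add: f_def)
  have lip_e: "norm (e x - e y) \<le> 1 * norm (x - y)"
    if "x \<in> cball 0 (1 / K)" "y \<in> cball 0 (1 / K)" for x y
  proof (rule order_trans[OF Lip[OF that] mult_right_mono])
    show "K * max (norm x) (norm y) \<le> 1" using that K by (auto simp: max_def field_simps)
  qed simp
  have e_cont: "continuous_on (cball 0 (1 / K)) e"
    by (rule lipschitz_on_continuous_on[of 1], rule lipschitz_onI) (use lip_e in \<open>auto simp: dist_norm\<close>)
  have surj: "\<exists>x \<in> ball 0 (1 / K). f x = y" if y: "y \<in> ball 0 (1 / (2 * K))" for y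
  proof -
    have small: "norm (y - e x) < 1 / K" if x: "x \<in> cball 0 (1 / K)" for x
    proof -
      have "norm (e x) \<le> K * (norm x)\<^sup>2 / 2"
        using quadratic_bound_of_local_Lipschitz[OF e0 less_imp_le[OF K] Lip x] .
      also have "\<dots> \<le> K * (1 / K)\<^sup>2 / 2"
        using x K by (intro divide_right_mono mult_left_mono power_mono) auto
      also have "\<dots> = 1 / (2 * K)" using K by (simp add: power2_eq_square)
      finally have "norm (e x) \<le> 1 / (2 * K)" .
      then have "norm (y - e x) < 1 / (2 * K) + 1 / (2 * K)"
        using y norm_triangle_ineq4[of y "e x"] by simp
      then show ?thesis by simp
    qed
    have "continuous_on (cball 0 (1 / K)) (\<lambda>x. y - e x)"
      by (intro continuous_intros e_cont)
    moreover have "(\<lambda>x. y - e x) \<in> cball 0 (1 / K) \<rightarrow> cball 0 (1 / K)"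
      using less_imp_le[OF small] by auto
    ultimately obtain x where x: "x \<in> cball 0 (1 / K)" "y - e x = x"
      using brouwer_ball[of "1 / K" 0 "\<lambda>x. y - e x"] K by auto
    then have "x \<in> ball 0 (1 / K)" using small[OF x(1)] by simp
    moreover have "f x = y" using x(2) by (simp add: f_def algebra_simps)
    ultimately show ?thesis by blast
  qed
  have f_cont: "continuous_on (ball 0 (1 / K)) f"
    unfolding f_def
    by (intro continuous_intros continuous_on_subset[OF e_cont] ball_subset_cball)
  obtain k where hom: "homeomorphism (ball 0 (1 / K)) (f ` ball 0 (1 / K)) f k"
    using invariance_of_domain_homeomorphism[OF open_ball f_cont _ inj] by auto
  define W where "W = ball (0 :: 'a) (1 / (2 * K))"
  define V where "V = ball 0 (1 / K) \<inter> f -` W"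
  have W_sub: "W \<subseteq> f ` ball 0 (1 / K)" using surj by (force simp: W_def)
  have V_eq: "V = k ` W"
  proof (intro equalityI subsetI)
    fix x assume "x \<in> V"
    then have "k (f x) = x" "f x \<in> W" using homeomorphism_apply1[OF hom] by (auto simp: V_def)
    then show "x \<in> k ` W" by (metis imageI)
  next
    fix x assume "x \<in> k ` W"
    then obtain y where y: "y \<in> W" "x = k y" by blast
    then have "f x = y" "x \<in> ball 0 (1 / K)"
      using W_sub homeomorphism_apply2[OF hom, of y] homeomorphism_image2[OF hom] by blast+
    then show "x \<in> V" using y(1) by (simp add: V_def)
  qed
  have "open V"
    unfolding V_def W_def by (rule continuous_open_preimage[OF f_cont]) auto
  moreover have "connected V"
    unfolding V_eq
    by (rule connected_continuous_image[OF continuous_on_subset[OF homeomorphism_cont2[OF hom] W_sub]])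
       (simp add: W_def)
  moreover have "bij_betw f V W"
    using inj_on_subset[OF inj] W_sub unfolding bij_betw_def V_def by blast
  moreover have "V \<subseteq> ball 0 (1 / K)" by (simp add: V_def)
  ultimately show "\<exists>V \<subseteq> ball 0 (1 / K). open V \<and> connected V \<and>
      bij_betw (\<lambda>x. x + e x) V (ball 0 (1 / (2 * K)))"
    unfolding f_def W_def by blast
qed

section \<open>Wirtinger derivatives\<close>

lemma norm_cnj_vec: "norm (cnj_vec v) = norm v"
  by (simp add: cnj_vec_def norm_vec_def)

lemma cnj_vec_diff: "cnj_vec (v - w) = cnj_vec v - cnj_vec w"
  by (simp add: cnj_vec_def vec_eq_iff)

lemma bounded_linear_cnj_vec: "bounded_linear cnj_vec"
proof (rule bounded_linear_intro)
  show "norm (cnj_vec v) \<le> norm v * 1" for v :: "complex ^ 'n" by (simp add: norm_cnj_vec)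
qed (simp_all add: cnj_vec_def vec_eq_iff)

lemma matrix_vector_mult_axis: "(A *v axis j c) $ i = A $ i $ j * (c :: complex)"
  by (simp add: matrix_vector_mult_def axis_def if_distrib cong: if_cong)

lemma jacobians_of_pluriharmonic:
  fixes f :: "complex ^ 'n \<Rightarrow> complex ^ 'm"
  assumes "(f has_derivative (\<lambda>v. A *v v + cnj_vec (B *v v))) (at z)"
  shows "jacobian_z f z = A" and "jacobian_zbar f z = (\<chi> i. cnj_vec (B $ i))"
proof -
  have D: "frechet_derivative f (at z) = (\<lambda>v. A *v v + cnj_vec (B *v v))"
    using frechet_derivative_at[OF assms] by simp
  show "jacobian_z f z = A"
    by (simp add: jacobian_z_def D vec_eq_iff matrix_vector_mult_axis cnj_vec_def algebra_simps)
  show "jacobian_zbar f z = (\<chi> i. cnj_vec (B $ i))"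
    by (simp add: jacobian_zbar_def D vec_eq_iff matrix_vector_mult_axis cnj_vec_def algebra_simps)
qed

lemma norm_matrix_vector_le: "norm (A *v v) \<le> matrix_norm A * norm (v :: complex ^ 'n)"
  unfolding matrix_norm_def by (rule onorm) simp

lemma norm_conjugate_matrix_vector_le:
  "norm (B *v v) \<le> matrix_norm (\<chi> i. cnj_vec (B $ i)) * norm v"
proof -
  have "(\<chi> i. cnj_vec (B $ i)) *v cnj_vec v = cnj_vec (B *v v)"
    by (simp add: vec_eq_iff matrix_vector_mult_def cnj_vec_def)
  then show ?thesis
    using norm_matrix_vector_le[of "\<chi> i. cnj_vec (B $ i)" "cnj_vec v"] by (simp add: norm_cnj_vec)
qed

section \<open>Univalence of the pluriharmonic mapping\<close>

theorem theorem5: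
  fixes f h g :: "complex ^ 'n \<Rightarrow> complex ^ 'n"
  assumes f_eq: "\<And>z. z \<in> ball 0 1 \<Longrightarrow> f z = h z + cnj_vec (g z)"
    and f0: "f 0 = 0"
    and fzbar0: "matrix_norm (jacobian_zbar f 0) = 0"
    and fz0: "jacobian_z f 0 = mat 1"
    and h_convex: "convex_map_on h (ball 0 1)"
    and h_biholo: "biholomorphic_map_on h (ball 0 1)"
    and g_holo: "holomorphic_map_on g (ball 0 1)"
    and dominated: "\<And>z. z \<in> ball 0 1 \<Longrightarrow>
      matrix_norm (jacobian_zbar f z) \<le> matrix_norm (jacobian_z f z)"
  shows "inj_on f (ball 0 rho1) \<and>
    (\<exists>R \<ge> R1. univalent_ball_in f (ball 0 rho1) 0 R)"
proof -
  have h_holo: "holomorphic_map_on h (ball 0 1)" and h_cvx: "convex (h ` ball 0 1)"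
    using h_convex by (auto simp: convex_map_on_def)
  obtain hi where hi_holo: "holomorphic_map_on hi (h ` ball 0 1)"
    and hi: "\<And>z. z \<in> ball 0 1 \<Longrightarrow> hi (h z) = z"
    using h_biholo unfolding biholomorphic_map_on_def by blast
  obtain A where A: "\<And>z. z \<in> ball 0 1 \<Longrightarrow> (h has_derivative (\<lambda>v. A z *v v)) (at z)"
    using h_holo unfolding holomorphic_map_on_def by metis
  obtain B where B: "\<And>z. z \<in> ball 0 1 \<Longrightarrow> (g has_derivative (\<lambda>v. B z *v v)) (at z)"
    using g_holo unfolding holomorphic_map_on_def by metis
  have f': "(f has_derivative (\<lambda>v. A z *v v + cnj_vec (B z *v v))) (at z)" if z: "z \<in> ball 0 1" for z
  proof (rule has_derivative_transform_within_open[OF _ open_ball z])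
    show "((\<lambda>z. h z + cnj_vec (g z)) has_derivative (\<lambda>v. A z *v v + cnj_vec (B z *v v))) (at z)"
      by (intro has_derivative_add A B z bounded_linear.has_derivative[OF bounded_linear_cnj_vec])
  qed (simp add: f_eq)
  note jac = jacobians_of_pluriharmonic[OF f']
  have A0: "A 0 = mat 1" using jac(1)[of 0] fz0 by simp
  have h'0: "(h has_derivative (\<lambda>v. v)) (at 0)" using A[of 0] A0 by simp
  have g'_le: "norm (B z *v v) \<le> matrix_norm (A z) * norm v" if "z \<in> ball 0 1" for z v
  proof -
    have "matrix_norm (\<chi> i. cnj_vec (B z $ i)) \<le> matrix_norm (A z)"
      using dominated[OF that] jac[OF that] by simp
    then show ?thesis
      using norm_conjugate_matrix_vector_le[of "B z" v] mult_right_mono[OF _ norm_ge_zero[of v]]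
      by (meson order_trans)
  qed
  have "norm (B 0 *v v) \<le> 0" for v
    using norm_conjugate_matrix_vector_le[of "B 0" v] fzbar0 jac(2)[of 0] by simp
  then have g'0: "(g has_derivative (\<lambda>v. 0)) (at 0)" using B[of 0] by simp

  define H where "H = (\<lambda>z. h z - h 0 - z)"
  have H': "(H has_derivative (\<lambda>v. (A z - mat 1) *v v)) (at z)" if "z \<in> ball 0 1" for z
    unfolding H_def using A[OF that]
    by (auto intro!: derivative_eq_intros simp: matrix_vector_mult_diff_rdistrib)
  have "((\<lambda>z. h z - h 0) has_derivative (\<lambda>v. A z *v v)) (at z)" if "z \<in> ball 0 1" for z
    using A[OF that] by (auto intro!: derivative_eq_intros)
  note hc' = this
  have half_in: "z \<in> ball 0 1" if "z \<in> ball 0 (1/2)" for z :: "complex ^ 'n" using that by simp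
  have small_in: "z \<in> ball 0 (1/2)" "z \<in> ball 0 1" if "z \<in> ball 0 (3/10)" for z :: "complex ^ 'n"
    using that by simp_all
  have hc_holo: "holomorphic_map_on (\<lambda>z. h z - h 0) (ball 0 (1/2))"
    and H_holo: "holomorphic_map_on H (ball 0 (1/2))"
    and H_holo': "holomorphic_map_on H (ball 0 (3/10))"
    and g_holo': "holomorphic_map_on g (ball 0 (3/10))"
    unfolding holomorphic_map_on_def using hc' H' B half_in small_in by blast+
  \<comment> \<open>The growth estimates on the ball of radius \<open>1/2\<close> are turned into derivative bounds on the ball of
      radius \<open>3/10\<close> with the factor \<open>(1/2) / ((1/2)\<^sup>2 - (3/10)\<^sup>2) = 25/8\<close>. The two radii nearly
      minimize the constant \<open>125/8\<close> obtained below, which has to stay below \<open>m2 + m3\<close>.\<close>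
  have hc_bound: "norm (h z - h 0) \<le> 1" and H_bound: "norm (H z) \<le> 1/2"
    if "z \<in> ball 0 (1/2)" for z
  proof -
    have z: "norm z < 1/2" using that by simp
    have "norm z / (1 - norm z) \<le> 1" using z by (simp add: divide_le_eq)
    then show "norm (h z - h 0) \<le> 1"
      using convex_map_growth(1)[OF h_holo h_cvx hi_holo hi h'0 half_in[OF that]] by linarith
    have "norm z * norm z \<le> 1/2 * norm z" using z by (intro mult_right_mono) auto
    then have "(norm z)\<^sup>2 / (1 - norm z) \<le> 1/2"
      using z by (simp add: divide_le_eq power2_eq_square)
    then show "norm (H z) \<le> 1/2"
      using convex_map_growth(2)[OF h_holo h_cvx hi_holo hi h'0 half_in[OF that]]
      unfolding H_def by linarith
  qed
  have A_le: "norm (A z *v v) \<le> 25/8 * norm v" if "z \<in> ball 0 (3/10)" for z v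
    using derivative_bound_smaller_ball[OF hc_holo hc_bound _ that hc'[OF small_in(2)[OF that]], of v]
    by (simp add: power2_eq_square)
  have H'_le: "norm ((A z - mat 1) *v v) \<le> 25/16 * norm v" if "z \<in> ball 0 (3/10)" for z v
    using derivative_bound_smaller_ball[OF H_holo H_bound _ that H'[OF small_in(2)[OF that]], of v]
    by (simp add: power2_eq_square)
  have B_le: "norm (B z *v v) \<le> 25/8 * norm v" if "z \<in> ball 0 (3/10)" for z v
  proof -
    have "matrix_norm (A z) \<le> 25/8"
      unfolding matrix_norm_def using A_le[OF that] by (rule onorm_le)
    from order_trans[OF g'_le[OF small_in(2)[OF that]] mult_right_mono[OF this norm_ge_zero]]
    show ?thesis .
  qed
  have H_Lip: "norm (H z - H w) \<le> 25/16 * norm (z - w)"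
    and g_Lip: "norm (g z - g w) \<le> 25/8 * norm (z - w)"
    if "z \<in> ball 0 (3/10)" "w \<in> ball 0 (3/10)" for z w
    by (rule Lipschitz_from_derivative_bound[OF convex_ball H' H'_le that], simp, assumption,
        rule Lipschitz_from_derivative_bound[OF convex_ball B B_le that], simp, assumption)
  have H'0: "(H has_derivative (\<lambda>v. 0)) (at 0)" using H'[of 0] A0 by simp

  define K where "K = m2 + m3"
  have K: "125/8 \<le> K" "10/3 < K" "0 < K" using m2_approx m3_eq by (simp_all add: K_def)
  define e where "e = (\<lambda>z. H z + cnj_vec (g z) - cnj_vec (g 0))"
  have f_e: "f z = z + e z" if "z \<in> ball 0 1" for z
  proof -
    have "h 0 + cnj_vec (g 0) = 0" using f_eq[of 0] f0 by simp
    then show ?thesis using f_eq[OF that] by (simp add: e_def H_def algebra_simps)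
  qed
  have e_Lip: "norm (e z - e w) \<le> K * max (norm z) (norm w) * norm (z - w)"
    if "z \<in> cball 0 (1 / K)" "w \<in> cball 0 (1 / K)" for z w
  proof -
    define m where "m = max (norm z) (norm w) * norm (z - w)"
    have "1 / K < 3/10" using K by (simp add: divide_less_eq)
    then have zw: "z \<in> ball 0 (3/10)" "w \<in> ball 0 (3/10)" using that by auto
    have "e z - e w = (H z - H w) + cnj_vec (g z - g w)"
      by (simp add: e_def cnj_vec_diff)
    then have "norm (e z - e w) \<le> norm (H z - H w) + norm (g z - g w)"
      by (metis norm_cnj_vec norm_triangle_ineq)
    \<comment> \<open>Both constants are the Lipschitz constants \<open>25/16\<close> and \<open>25/8\<close> divided by the radius \<open>3/10\<close>.\<close>
    also have "\<dots> \<le> 125/24 * m + 125/12 * m"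
    proof (rule add_mono)
      show "norm (H z - H w) \<le> 125/24 * m"
        using difference_bound_of_critical_point[OF H_holo' H_Lip H'0 zw]
        by (simp add: m_def mult.assoc)
      show "norm (g z - g w) \<le> 125/12 * m"
        using difference_bound_of_critical_point[OF g_holo' g_Lip g'0 zw]
        by (simp add: m_def mult.assoc)
    qed
    also have "\<dots> = 125/8 * m" by simp
    also have "\<dots> \<le> K * m" using K(1) by (intro mult_right_mono) (auto simp: m_def max_def)
    finally show ?thesis by (simp add: m_def mult.assoc)
  qed
  have e0: "e 0 = 0" by (simp add: e_def H_def)
  have rho: "rho1 = 1 / K" and R: "R1 = 1 / (2 * K)" by (simp_all add: rho1_def R1_def K_def)
  have ball_in: "z \<in> ball 0 1" if "z \<in> ball 0 rho1" for z :: "complex ^ 'n"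
  proof -
    have "1 / K < 1" using K by (simp add: divide_less_eq)
    then show ?thesis using that by (simp add: rho)
  qed
  have "inj_on f (ball 0 rho1) \<longleftrightarrow> inj_on (\<lambda>x. x + e x) (ball 0 rho1)"
    by (intro inj_on_cong f_e ball_in)
  then have "inj_on f (ball 0 rho1)"
    using perturbed_identity_univalent(1)[OF K(3) e0 e_Lip] unfolding rho by blast
  moreover have "univalent_ball_in f (ball 0 rho1) 0 R1"
  proof -
    obtain V where V: "V \<subseteq> ball 0 rho1" "open V" "connected V"
      and bij: "bij_betw (\<lambda>x. x + e x) V (ball 0 R1)"
      using perturbed_identity_univalent(2)[OF K(3) e0 e_Lip] unfolding rho R by blast
    have "bij_betw f V (ball 0 R1) \<longleftrightarrow> bij_betw (\<lambda>x. x + e x) V (ball 0 R1)"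
      using V(1) f_e[OF ball_in] by (intro bij_betw_cong) auto
    then show ?thesis using V bij unfolding univalent_ball_in_def by blast
  qed
  ultimately show ?thesis by blast
qed

end
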